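(* Let $f:\operatorname{dom} f\subseteq\mathbb{R}^n\to\mathbb{R}$ be $\mathcal{C}^4$ on an open domain containing $\overline{B}_n(x^0;\Delta_S)$, where $x^0\in\operatorname{dom} f$ is the point of interest and $\Delta_S=\max_j\|s^j\|>0$ is the radius of $S=\begin{bmatrix}s^1&\cdots&s^m\end{bmatrix}\in\mathbb{R}^{n\times m}$. Let $T_j=-s^j$ for all $j\in\{1,\dots,m\}$. Denote by $L_{\nabla^3 f}\ge 0$ the Lipschitz constant of $\nabla^3 f$ on $\overline{B}_n(x^0;\Delta_S)$. Let $D\in\mathbb{R}^{n\times n}$ be the diagonal matrix with $D_{i,i}=[\nabla^2 f(x^0)]_{i,i}$ for all $i\in\{1,\dots,n\}$. If $S$ is a partial diagonal matrix with full column rank, then $$\left\|\operatorname{P}_{S,T_{1:m}}\nabla_c^2 f(x^0;S,T_{1:m})-\operatorname{P}_{S,T_{1:m}}\nabla^2 f(x^0)\right\|=\left\|\nabla_c^2 f(x^0;S,T_{1:m})-\operatorname{P}_{S,T_{1:m}}D\right\|\le\frac{1}{12}L_{\nabla^3 f}\,\Delta_S^2.$$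
   Context: $\|\cdot\|$ is the Euclidean norm on vectors and the induced (spectral) norm on matrices. $\overline{B}_n(x^0;\Delta)$ is the closed ball in $\mathbb{R}^n$ centered at $x^0$ of radius $\Delta$. $A^\dagger$ is the Moore-Penrose pseudoinverse of a real matrix $A$ (vectors in $\mathbb{R}^n$ are $n\times1$ matrices). $e_m^j$ is the $j$-th standard basis vector of $\mathbb{R}^m$. $\oplus$ is the Minkowski sum; a matrix is identified with the set of its columns, so $x^0\oplus S=\{x^0+s^1,\dots,x^0+s^m\}$. Generalized simplex gradient: for a matrix $T=\begin{bmatrix}t^1&\cdots&t^k\end{bmatrix}\in\mathbb{R}^{n\times k}$ and a point $x$ with $x\in\operatorname{dom} f$ and $x\oplus T\subset\operatorname{dom} f$, $\nabla_s f(x;T)=(T^\top)^\dagger\,\delta_s f(x;T)\in\mathbb{R}^n$, where $\delta_s f(x;T)=\big(f(x+t^1)-f(x),\dots,f(x+t^k)-f(x)\big)^\top\in\mathbb{R}^k$. Generalized simplex Hessian: for $S=\begin{bmatrix}s^1&\cdots&s^m\end{bmatrix}\in\mathbb{R}^{n\times m}$ and $T_{1:m}=\{T_1,\dots,T_m\}$ with $T_j\in\mathbb{R}^{n\times k_j}$, such that $x^0\oplus T_j$, $x^0\oplus S$, $x^0+s^j\oplus T_j$ are contained in $\operatorname{dom} f$ for all $j$, $\nabla_s^2 f(x^0;S,T_{1:m})=(S^\top)^\dagger\,\delta_s^2 f(x^0;S,T_{1:m})\in\mathbb{R}^{n\times n}$, where $\delta_s^2 f(x^0;S,T_{1:m})\in\mathbb{R}^{m\times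 n}$ is the matrix whose $j$-th row is $\big(\nabla_s f(x^0+s^j;T_j)-\nabla_s f(x^0;T_j)\big)^\top$. Generalized centered simplex Hessian: $\nabla_c^2 f(x^0;S,T_{1:m})=\tfrac12\big(\nabla_s^2 f(x^0;S,T_{1:m})+\nabla_s^2 f(x^0;-S,-T_{1:m})\big)$, where $-T_{1:m}=\{-T_1,\dots,-T_m\}$; it is defined when $x^0\oplus S\oplus T_j$, $x^0\oplus(-S)\oplus(-T_j)$, $x^0\oplus(\pm S)$ and $x^0\oplus(\pm T_j)$ are contained in $\operatorname{dom} f$ for all $j$. Projection operator: for $M\in\mathbb{R}^{n\times n}$, $\operatorname{P}_{S,T_{1:m}}M=\sum_{j=1}^m(S^\top)^\dagger e_m^j(e_m^j)^\top S^\top M\,T_jT_j^\dagger$. Partial diagonal matrix: $M\in\mathbb{R}^{n\times m}$, $m\le n$, is a partial diagonal matrix if there exists a diagonal matrix $D'\in\mathbb{R}^{n\times n}$ such that for each column $Me^j$, $j\in\{1,\dots,m\}$, there is a distinct index $i\in\{1,\dots,n\}$ (different columns of $M$ get different indices) with $Me^j=D'e^i$. Standing assumptions: all points required by these definitions lie in $\operatorname{dom} f$; $S$ and all $T_j$ are non-empty with non-null rank. *)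

theory Defs
  imports "HOL-Analysis.Analysis"
begin

text \<open>
  An n by m matrix is an element of \<open>real^'m^'n\<close>. The norm that the library puts on this
  type is the Frobenius norm, so the spectral norm is introduced separately.
\<close>

definition spectral_norm :: "real^'m^'n \<Rightarrow> real" where
  "spectral_norm A = onorm (\<lambda>v. A *v v)"

definition is_moore_penrose :: "real^'m^'n \<Rightarrow> real^'n^'m \<Rightarrow> bool" where
  "is_moore_penrose A X \<longleftrightarrow>
     A ** X ** A = A \<and> X ** A ** X = X \<and>
     transpose (A ** X) = A ** X \<and> transpose (X ** A) = X ** A"

lemma is_moore_penrose_unique:
  assumes X: "is_moore_penrose A X" and Y: "is_moore_penrose A Y"
  shows "X = Y"
proof -
  have "A ** X = transpose (A ** Y ** A ** X)"
    using X Y by (simp add: is_moore_penrose_def)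
  also have "\<dots> = transpose (A ** X) ** transpose (A ** Y)"
    by (simp add: matrix_transpose_mul matrix_mul_assoc)
  also have "\<dots> = A ** X ** A ** Y"
    using X Y by (simp add: is_moore_penrose_def matrix_mul_assoc)
  also have "\<dots> = A ** Y"
    using X by (simp add: is_moore_penrose_def)
  finally have AX: "A ** X = A ** Y" .
  have "X ** A = transpose (X ** (A ** Y ** A))"
    using X Y by (simp add: is_moore_penrose_def)
  also have "\<dots> = transpose (Y ** A) ** transpose (X ** A)"
    by (simp add: matrix_transpose_mul matrix_mul_assoc)
  also have "\<dots> = (Y ** A) ** (X ** A)"
    using X Y by (simp add: is_moore_penrose_def)
  also have "\<dots> = Y ** (A ** X ** A)"
    by (simp add: matrix_mul_assoc)
  also have "\<dots> = Y ** A"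
    using X by (simp add: is_moore_penrose_def)
  finally have XA: "X ** A = Y ** A" .
  have "X = X ** A ** X" using X by (simp add: is_moore_penrose_def)
  also have "\<dots> = Y ** (A ** X)" by (simp add: XA matrix_mul_assoc)
  also have "\<dots> = Y ** A ** Y" by (simp add: AX matrix_mul_assoc)
  also have "\<dots> = Y" using Y by (simp add: is_moore_penrose_def)
  finally show ?thesis .
qed

definition pinv :: "real^'m^'n \<Rightarrow> real^'n^'m" where
  "pinv A = (THE X. is_moore_penrose A X)"

definition simplex_delta :: "(real^'n \<Rightarrow> real) \<Rightarrow> real^'n \<Rightarrow> real^'k^'n \<Rightarrow> real^'k" where
  "simplex_delta f x T = (\<chi> i. f (x + column i T) - f x)"

definition simplex_gradient :: "(real^'n \<Rightarrow> real) \<Rightarrow> real^'n \<Rightarrow> real^'k^'n \<Rightarrow> real^'n" where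
  "simplex_gradient f x T = pinv (transpose T) *v simplex_delta f x T"

text \<open>
  In the family \<open>T\<close> all matrices have the same column type \<open>'k\<close>. This also accounts for matrices
  with different numbers of columns: appending a zero column to a matrix appends a zero row to its
  pseudoinverse and a zero entry to \<open>simplex_delta\<close>, so simplex gradients and the products
  \<open>T j ** pinv (T j)\<close> do not change.
\<close>

definition simplex_hessian_delta ::
    "(real^'n \<Rightarrow> real) \<Rightarrow> real^'n \<Rightarrow> real^'m^'n \<Rightarrow> ('m \<Rightarrow> real^'k^'n) \<Rightarrow> real^'n^'m" where
  "simplex_hessian_delta f x0 S T =
     (\<chi> j. simplex_gradient f (x0 + column j S) (T j) - simplex_gradient f x0 (T j))"

definition simplex_hessian ::
    "(real^'n \<Rightarrow> real) \<Rightarrow> real^'n \<Rightarrow> real^'m^'n \<Rightarrow> ('m \<Rightarrow> real^'k^'n) \<Rightarrow> real^'n^'n" where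
  "simplex_hessian f x0 S T = pinv (transpose S) ** simplex_hessian_delta f x0 S T"

definition centered_simplex_hessian ::
    "(real^'n \<Rightarrow> real) \<Rightarrow> real^'n \<Rightarrow> real^'m^'n \<Rightarrow> ('m \<Rightarrow> real^'k^'n) \<Rightarrow> real^'n^'n" where
  "centered_simplex_hessian f x0 S T =
     (1/2) *\<^sub>R (simplex_hessian f x0 S T + simplex_hessian f x0 (- S) (\<lambda>j. - T j))"

text \<open>
  The function \<open>f\<close> is total; its domain is the explicit set \<open>X\<close>. The sumsets
  below contain every point at which the centered simplex Hessian evaluates \<open>f\<close>.
\<close>

definition centered_simplex_hessian_defined ::
    "(real^'n) set \<Rightarrow> real^'n \<Rightarrow> real^'m^'n \<Rightarrow> ('m \<Rightarrow> real^'k^'n) \<Rightarrow> bool" where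
  "centered_simplex_hessian_defined X x0 S T \<longleftrightarrow>
     x0 \<in> X \<and>
     x0 +o columns S \<subseteq> X \<and> x0 +o columns (- S) \<subseteq> X \<and>
     (\<forall>j. x0 +o columns (T j) \<subseteq> X \<and> x0 +o columns (- T j) \<subseteq> X \<and>
          x0 +o (columns S + columns (T j)) \<subseteq> X \<and>
          x0 +o (columns (- S) + columns (- T j)) \<subseteq> X)"

definition proj_op :: "real^'m^'n \<Rightarrow> ('m \<Rightarrow> real^'k^'n) \<Rightarrow> real^'n^'n \<Rightarrow> real^'n^'n" where
  "proj_op S T M =
     (\<Sum>j\<in>UNIV. pinv (transpose S)
        ** (columnvector (axis j 1) :: real^1^'m) ** (rowvector (axis j 1) :: real^'m^1)
        ** transpose S ** M ** T j ** pinv (T j))"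

definition diagonal_matrix :: "real^'n^'n \<Rightarrow> bool" where
  "diagonal_matrix A \<longleftrightarrow> (\<forall>i j. i \<noteq> j \<longrightarrow> A $ i $ j = 0)"

definition partial_diagonal_matrix :: "real^'m^'n \<Rightarrow> bool" where
  "partial_diagonal_matrix M \<longleftrightarrow>
     CARD('m) \<le> CARD('n) \<and>
     (\<exists>D' :: real^'n^'n. diagonal_matrix D' \<and>
        (\<exists>\<sigma> :: 'm \<Rightarrow> 'n. inj \<sigma> \<and> (\<forall>j. column j M = column (\<sigma> j) D')))"

definition radius :: "real^'m^'n \<Rightarrow> real" where
  "radius S = Max (range (\<lambda>j. norm (column j S)))"

text \<open>
  The derivative as a map into the bounded linear maps. Iterating it gives the higher derivatives as
  curried multilinear maps, which carry the operator norm.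
\<close>

definition fderiv ::
    "('a::real_normed_vector \<Rightarrow> 'b::real_normed_vector) \<Rightarrow> 'a \<Rightarrow> 'a \<Rightarrow>\<^sub>L 'b" where
  "fderiv f x = Blinfun (frechet_derivative f (at x))"

text \<open>Only meant for open sets \<open>U\<close>, on which \<open>fderiv\<close> is the derivative within \<open>U\<close>.\<close>

definition C4_on :: "('a::real_normed_vector) set \<Rightarrow> ('a \<Rightarrow> 'b::real_normed_vector) \<Rightarrow> bool" where
  "C4_on U f \<longleftrightarrow>
     f differentiable_on U \<and>
     fderiv f differentiable_on U \<and>
     fderiv (fderiv f) differentiable_on U \<and>
     fderiv (fderiv (fderiv f)) differentiable_on U \<and>
     continuous_on U (fderiv (fderiv (fderiv (fderiv f))))"

definition hessian :: "(real^'n \<Rightarrow> real) \<Rightarrow> real^'n \<Rightarrow> real^'n^'n" where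
  "hessian f x = (\<chi> i j. blinfun_apply (blinfun_apply (fderiv (fderiv f) x) (axis i 1)) (axis j 1))"

end

theory Submission
  imports Defs
begin

text \<open>
  Each column of \<open>S\<close> is a nonzero multiple \<open>a\<^sub>j e\<^sub>i\<close> of a basis vector with \<open>i = \<sigma> j\<close>. With
  \<open>T\<^sub>j = -s\<^sup>j\<close> both simplex Hessians therefore equal the diagonal matrix whose entry at \<open>i\<close> is the
  second difference quotient \<open>(f (x + s\<^sup>j) + f (x - s\<^sup>j) - 2 f x) / a\<^sub>j\<^sup>2\<close>, and the projection
  operator keeps exactly the diagonal entries with index in the range of \<open>\<sigma>\<close>. So the spectral norm
  is a maximum of errors of such quotients. Along the segment, the third derivative of
  \<open>t \<mapsto> f (x + t s) + f (x - t s)\<close> is at most \<open>2 t L |s|\<^sup>4\<close>; integrating three times gives the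
  factor \<open>2 / 24 = 1 / 12\<close>.
\<close>

section \<open>Derivatives along a segment and the remainder of the second difference\<close>

lemma has_derivative_fderiv:
  assumes "open U" "g differentiable_on U" "x \<in> U"
  shows "(g has_derivative blinfun_apply (fderiv g x)) (at x)"
proof -
  have "(g has_derivative frechet_derivative g (at x)) (at x)"
    using assms by (metis at_within_open differentiable_on_def frechet_derivative_works)
  then show ?thesis
    by (simp add: fderiv_def bounded_linear_Blinfun_apply has_derivative_bounded_linear)
qed

lemma has_vector_derivative_fderiv_line:
  assumes "open U" "g differentiable_on U" "x + t *\<^sub>R s \<in> U"
  shows "((\<lambda>t. g (x + t *\<^sub>R s)) has_vector_derivative fderiv g (x + t *\<^sub>R s) s) (at t)"
proof -
  have "((\<lambda>t. x + t *\<^sub>R s) has_vector_derivative s) (at t)"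
    by (auto intro!: derivative_eq_intros)
  from vector_derivative_diff_chain_within[OF this has_derivative_at_withinI,
      OF has_derivative_fderiv[OF assms]]
  show ?thesis
    by (simp add: o_def)
qed

text \<open>The mean value inequality against the comparison function
  \<open>C / Suc n * t ^ Suc n\<close>, whose derivative is \<open>C * t ^ n\<close>. It does the
  work of integrating a bound once.\<close>

lemma norm_bound_from_vector_derivative:
  fixes g g' :: "real \<Rightarrow> 'b::real_normed_vector"
  assumes deriv: "\<And>t. 0 \<le> t \<Longrightarrow> t \<le> b \<Longrightarrow> (g has_vector_derivative g' t) (at t)"
    and bound: "\<And>t. 0 \<le> t \<Longrightarrow> t \<le> b \<Longrightarrow> norm (g' t) \<le> C * t ^ n"
    and "g 0 = 0" "0 \<le> t" "t \<le> b"
  shows "norm (g t) \<le> C / Suc n * t ^ Suc n"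
proof (cases "t = 0")
  case False
  then have "0 < t" using assms by simp
  have "norm (g t - g 0) \<le> C / Suc n * t ^ Suc n - C / Suc n * 0 ^ Suc n"
  proof (rule differentiable_bound_general[where f'=g' and \<phi>'="\<lambda>t. C * t ^ n", OF \<open>0 < t\<close>])
    show "continuous_on {0..t} g"
      using deriv \<open>t \<le> b\<close>
      by (intro continuous_at_imp_continuous_on ballI)
        (meson atLeastAtMost_iff has_vector_derivative_continuous order_trans)
    show "continuous_on {0..t} (\<lambda>t. C / Suc n * t ^ Suc n)"
      by (intro continuous_intros)
    show "((\<lambda>t. C / Suc n * t ^ Suc n) has_vector_derivative C * x ^ n) (at x)" for x :: real
      unfolding has_real_derivative_iff_has_vector_derivative[symmetric]
      by (auto intro!: derivative_eq_intros simp del: power_Suc)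
  qed (use deriv bound \<open>t \<le> b\<close> in auto)
  then show ?thesis using \<open>g 0 = 0\<close> by simp
qed (use assms in simp)

lemma second_difference_bound:
  fixes f :: "'a::real_normed_vector \<Rightarrow> 'b::real_normed_vector"
  assumes "open U" "cball x (norm s) \<subseteq> U"
    and "f differentiable_on U" "fderiv f differentiable_on U"
    and "fderiv (fderiv f) differentiable_on U"
    and lip: "L-lipschitz_on (cball x (norm s)) (fderiv (fderiv (fderiv f)))"
  shows "norm (f (x + s) + f (x - s) - 2 *\<^sub>R f x - fderiv (fderiv f) x s s) \<le> L / 12 * norm s ^ 4"
proof -
  \<comment> \<open>kept opaque, as the simplifier would turn \<open>x + t *\<^sub>R (- s)\<close> into \<open>x - t *\<^sub>R s\<close>\<close>
  define u where "u = - s"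
  \<comment> \<open>Subtracting the quadratic term makes \<open>g0\<close> and its first two
    derivatives \<open>g1\<close> and \<open>g2\<close> vanish at 0, the start value that each
    integration needs.\<close>
  define g0 where "g0 t = f (x + t *\<^sub>R s) + f (x + t *\<^sub>R u) - 2 *\<^sub>R f x
      - t\<^sup>2 *\<^sub>R fderiv (fderiv f) x s s" for t
  define g1 where "g1 t = fderiv f (x + t *\<^sub>R s) s + fderiv f (x + t *\<^sub>R u) u
      - (2 * t) *\<^sub>R fderiv (fderiv f) x s s" for t
  define g2 where "g2 t = fderiv (fderiv f) (x + t *\<^sub>R s) s s
      + fderiv (fderiv f) (x + t *\<^sub>R u) u u - 2 *\<^sub>R fderiv (fderiv f) x s s" for t
  define g3 where "g3 t = fderiv (fderiv (fderiv f)) (x + t *\<^sub>R s) s s s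
      + fderiv (fderiv (fderiv f)) (x + t *\<^sub>R u) u u u" for t
  have ball: "x + t *\<^sub>R s \<in> cball x (norm s)" "x + t *\<^sub>R u \<in> cball x (norm s)"
    if "0 \<le> t" "t \<le> 1" for t
    using that by (auto simp: u_def dist_norm mult_left_le_one_le)
  note line = has_vector_derivative_fderiv_line[OF \<open>open U\<close>]
  \<comment> \<open>Evaluation at a fixed vector is bounded linear, so it commutes with
    differentiation in \<open>t\<close>.\<close>
  note apply1 = bounded_linear.has_vector_derivative[OF blinfun.bounded_linear_left]
  have d0: "(g0 has_vector_derivative g1 t) (at t)" if "0 \<le> t" "t \<le> 1" for t
    unfolding g0_def g1_def using that ball[OF that] assms
    by (auto intro!: derivative_eq_intros line)
  have d1: "(g1 has_vector_derivative g2 t) (at t)" if "0 \<le> t" "t \<le> 1" for t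
    unfolding g1_def g2_def using that ball[OF that] assms
    by (auto intro!: derivative_eq_intros line apply1)
  have d2: "(g2 has_vector_derivative g3 t) (at t)" if "0 \<le> t" "t \<le> 1" for t
    unfolding g2_def g3_def using that ball[OF that] assms
    by (auto intro!: derivative_eq_intros line apply1)
  have b3: "norm (g3 t) \<le> (2 * L * norm s ^ 4) * t ^ 1" if t: "0 \<le> t" "t \<le> 1" for t
  proof -
    let ?F = "fderiv (fderiv (fderiv f))"
    let ?G = "?F (x + t *\<^sub>R s) - ?F (x + t *\<^sub>R u)"
    have "norm ?G \<le> L * norm ((x + t *\<^sub>R s) - (x + t *\<^sub>R u))"
      using lipschitz_onD[OF lip ball[OF t]] by (simp only: dist_norm)
    also have "(x + t *\<^sub>R s) - (x + t *\<^sub>R u) = (2 * t) *\<^sub>R s"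
      by (simp add: u_def algebra_simps scaleR_2 flip: scaleR_scaleR)
    finally have G: "norm ?G \<le> L * (2 * t * norm s)" using t by simp
    \<comment> \<open>By trilinearity, \<open>u = - s\<close> contributes three minus signs, so the
      sum becomes a difference of third derivatives.\<close>
    have "g3 t = ?G s s s"
      by (simp add: g3_def u_def blinfun.bilinear_simps)
    also have "norm \<dots> \<le> norm ?G * norm s * norm s * norm s"
      by (meson norm_blinfun order_trans mult_right_mono norm_ge_zero)
    also have "\<dots> \<le> L * (2 * t * norm s) * norm s * norm s * norm s"
      using G by (intro mult_right_mono) auto
    finally show ?thesis by (simp add: power4_eq_xxxx mult_ac)
  qed
  have z: "g0 0 = 0" "g1 0 = 0" "g2 0 = 0"
    by (simp_all add: g0_def g1_def g2_def u_def blinfun.bilinear_simps scaleR_2)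
  note step = norm_bound_from_vector_derivative[where b=1]
  \<comment> \<open>The three integrations divide the constant by 2, 3 and 4 in turn: 2 / 24 = 1 /
    12.\<close>
  have b2: "norm (g2 t) \<le> L * norm s ^ 4 * t ^ 2" if "0 \<le> t" "t \<le> 1" for t
    using step[OF d2 b3 z(3) that] by (simp add: numeral_2_eq_2)
  have b1: "norm (g1 t) \<le> L * norm s ^ 4 / 3 * t ^ 3" if "0 \<le> t" "t \<le> 1" for t
    using step[OF d1 b2 z(2) that] by (simp add: numeral_3_eq_3)
  have "norm (g0 1) \<le> L * norm s ^ 4 / 12"
    using step[OF d0 b1 z(1), of 1] by simp
  then show ?thesis by (simp add: g0_def u_def)
qed

section \<open>Pseudoinverses and simplex gradients for a single direction\<close>

lemma pinv_eqI: "is_moore_penrose A X \<Longrightarrow> pinv A = X"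
  unfolding pinv_def by (rule the_equality) (auto intro: is_moore_penrose_unique)

text \<open>For nonzero \<open>v\<close> the candidate is a left inverse, and its product with
  \<open>v\<close> on the left is symmetric. For \<open>v = 0\<close> the convention
  \<open>1 / 0 = 0\<close> gives the zero matrix, as it should.\<close>

lemma is_moore_penrose_columnvector:
  fixes v :: "real^'n"
  shows "is_moore_penrose (columnvector v :: real^1^'n) ((1 / (v \<bullet> v)) *\<^sub>R rowvector v)"
proof (cases "v = 0")
  case False
  have "(rowvector v :: real^'n^1) ** (columnvector v :: real^1^'n) = mat (v \<bullet> v)"
    by (simp add: vec_eq_iff matrix_matrix_mult_def rowvector_def columnvector_def inner_vec_def mat_def)
  then have inv: "(1 / (v \<bullet> v)) *\<^sub>R (rowvector v :: real^'n^1) ** (columnvector v :: real^1^'n) = mat 1"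
    using False by (simp add: vec_eq_iff matrix_matrix_mult_def mat_def flip: sum_divide_distrib)
  have "transpose ((columnvector v :: real^1^'n) ** ((1 / (v \<bullet> v)) *\<^sub>R rowvector v))
      = (columnvector v :: real^1^'n) ** ((1 / (v \<bullet> v)) *\<^sub>R rowvector v)"
    by (simp add: vec_eq_iff transpose_def matrix_matrix_mult_def rowvector_def columnvector_def)
  then show ?thesis
    by (simp add: is_moore_penrose_def inv flip: matrix_mul_assoc)
qed (simp add: is_moore_penrose_def vec_eq_iff transpose_def matrix_matrix_mult_def
    rowvector_def columnvector_def)

lemma is_moore_penrose_transpose:
  "is_moore_penrose A Y \<Longrightarrow> is_moore_penrose (transpose A) (transpose Y)"
  unfolding is_moore_penrose_def by (metis matrix_transpose_mul matrix_mul_assoc)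

lemma simplex_gradient_columnvector:
  fixes v :: "real^'n"
  shows "simplex_gradient f x (columnvector v :: real^1^'n) = ((f (x + v) - f x) / (v \<bullet> v)) *\<^sub>R v"
proof -
  have "pinv (transpose (columnvector v :: real^1^'n)) = transpose ((1 / (v \<bullet> v)) *\<^sub>R rowvector v)"
    by (intro pinv_eqI is_moore_penrose_transpose is_moore_penrose_columnvector)
  then show ?thesis
    by (simp add: simplex_gradient_def simplex_delta_def vec_eq_iff matrix_vector_mult_def
        transpose_def rowvector_def columnvector_def column_def)
qed

text \<open>This is the orthogonal projection onto the line spanned by \<open>v\<close>.\<close>

lemma columnvector_mult_pinv:
  fixes v :: "real^'n"
  shows "(columnvector v :: real^1^'n) ** pinv (columnvector v) = (\<chi> i k. v $ i * v $ k / (v \<bullet> v))"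
  unfolding pinv_eqI[OF is_moore_penrose_columnvector]
  by (simp add: vec_eq_iff matrix_matrix_mult_def rowvector_def columnvector_def)

text \<open>The step \<open>- column j S\<close> leads from the shifted point back to
  \<open>x\<close>, so the two gradients in row \<open>j\<close> together involve only three values
  of \<open>f\<close>.\<close>

lemma simplex_hessian_delta_reflected:
  fixes S :: "real^'m^'n" and T :: "'m \<Rightarrow> real^1^'n"
  assumes "\<And>j. T j = columnvector (- column j S)"
  shows "simplex_hessian_delta f x S T = (\<chi> j. ((f (x + column j S) + f (x - column j S) - 2 * f x)
           / (column j S \<bullet> column j S)) *\<^sub>R column j S)"
  by (simp add: simplex_hessian_delta_def assms simplex_gradient_columnvector vec_eq_iff
      flip: add_divide_distrib diff_divide_distrib)
    (simp add: field_simps)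

section \<open>Matrices whose columns are nonzero multiples of distinct basis vectors\<close>

context
  fixes S :: "real^'m^'n" and \<sigma> :: "'m \<Rightarrow> 'n" and a :: "'m \<Rightarrow> real"
  assumes inj: "inj \<sigma>" and col: "\<And>j. column j S = axis (\<sigma> j) (a j)" and nz: "\<And>j. a j \<noteq> 0"
begin

lemma partial_diagonal_nth: "S $ i $ j = (if i = \<sigma> j then a j else 0)"
  using col[of j] by (simp add: column_def axis_def vec_eq_iff)

text \<open>Injectivity of \<open>\<sigma>\<close> makes the candidate a right inverse of
  \<open>transpose S\<close>. The product in the other order is diagonal, hence symmetric.\<close>

lemma is_moore_penrose_partial_diagonal:
  "is_moore_penrose (transpose S) (\<chi> i j. if i = \<sigma> j then 1 / a j else 0)"
proof -
  let ?Y = "(\<chi> i j. if i = \<sigma> j then 1 / a j else 0) :: real^'m^'n"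
  have "transpose S ** ?Y = mat 1"
    using inj nz by (simp add: vec_eq_iff matrix_matrix_mult_def transpose_def partial_diagonal_nth
        mat_def if_distrib[of "\<lambda>x. x * _"] inj_eq cong: if_cong)
  moreover have "transpose (?Y ** transpose S) = ?Y ** transpose S"
    using nz by (auto simp add: vec_eq_iff matrix_matrix_mult_def transpose_def partial_diagonal_nth
        intro!: sum.cong)
  ultimately show ?thesis
    by (simp add: is_moore_penrose_def flip: matrix_mul_assoc)
qed

text \<open>\<open>axis i (axis i 1)\<close> is the matrix unit at position (i, i). It arises as
  column \<open>j\<close> of the pseudoinverse, a multiple of a basis vector, times row
  \<open>j\<close> of the difference matrix, a multiple of the same one.\<close>

lemma simplex_hessian_reflected:
  assumes T: "\<And>j. T j = (columnvector (- column j S) :: real^1^'n)"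
  shows "simplex_hessian f x S T = (\<Sum>j\<in>UNIV. ((f (x + column j S) + f (x - column j S) - 2 * f x)
           / (a j)\<^sup>2) *\<^sub>R axis (\<sigma> j) (axis (\<sigma> j) 1))"
proof -
  have "column j S \<bullet> column j S = (a j)\<^sup>2" for j
    by (simp add: col inner_axis_axis power2_eq_square)
  then show ?thesis
    using nz unfolding simplex_hessian_def simplex_hessian_delta_reflected[OF T]
      pinv_eqI[OF is_moore_penrose_partial_diagonal]
    by (auto simp add: vec_eq_iff matrix_matrix_mult_def column_def partial_diagonal_nth axis_def
        intro!: sum.cong)
qed

text \<open>In each summand the factors on both sides of \<open>M\<close> collapse to the same
  matrix unit, which cuts out one diagonal entry of \<open>M\<close>.\<close>

lemma proj_op_reflected:
  assumes T: "\<And>j. T j = (columnvector (- column j S) :: real^1^'n)"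
  shows "proj_op S T M = (\<Sum>j\<in>UNIV. M $ \<sigma> j $ \<sigma> j *\<^sub>R axis (\<sigma> j) (axis (\<sigma> j) 1))"
proof -
  let ?c = "\<lambda>j. columnvector (axis j 1) :: real^1^'m" and ?r = "\<lambda>j. rowvector (axis j 1) :: real^'m^1"
  have E: "T j ** pinv (T j) = axis (\<sigma> j) (axis (\<sigma> j) 1)" for j
    unfolding T columnvector_mult_pinv using nz[of j]
    by (auto simp: col vec_eq_iff axis_def inner_axis_axis[unfolded axis_def])
  let ?Y = "(\<chi> i j. if i = \<sigma> j then 1 / a j else 0) :: real^'m^'n"
  have "?Y ** ?c j = columnvector (axis (\<sigma> j) (1 / a j))" for j
    by (simp add: vec_eq_iff matrix_matrix_mult_def columnvector_def axis_def
        if_distrib[of "\<lambda>x. _ * x"] cong: if_cong)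
  moreover have "?r j ** transpose S = rowvector (axis (\<sigma> j) (a j))" for j
    by (simp add: vec_eq_iff matrix_matrix_mult_def rowvector_def transpose_def
        partial_diagonal_nth axis_def if_distrib[of "\<lambda>x. x * _"] cong: if_cong)
  moreover have "(columnvector (axis (\<sigma> j) (1 / a j)) :: real^1^'n) ** rowvector (axis (\<sigma> j) (a j))
      = axis (\<sigma> j) (axis (\<sigma> j) 1)" for j
    using nz[of j] by (simp add: vec_eq_iff matrix_matrix_mult_def columnvector_def rowvector_def axis_def)
  ultimately have P: "pinv (transpose S) ** ?c j ** ?r j ** transpose S = axis (\<sigma> j) (axis (\<sigma> j) 1)" for j
    unfolding pinv_eqI[OF is_moore_penrose_partial_diagonal]
    by (metis matrix_mul_assoc)
  have "axis i (axis i 1) ** M ** axis i (axis i 1) = M $ i $ i *\<^sub>R axis i (axis i 1)" for i :: 'n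
    by (simp add: vec_eq_iff matrix_matrix_mult_def axis_def
        if_distrib[of "\<lambda>x. x * _"] if_distrib[of "\<lambda>x. _ * x"] if_distrib[of "\<lambda>x. x $ _"] cong: if_cong)
  \<comment> \<open>Regrouping only at \<open>T j\<close> exposes the product in \<open>E\<close>
    and keeps the left factor in the shape of \<open>P\<close>.\<close>
  then show ?thesis
    by (simp only: proj_op_def matrix_mul_assoc[symmetric, of _ "T _"] E P)
qed

end

section \<open>Entries and spectral norm of diagonal matrices\<close>

lemma diagonal_sum_nth:
  assumes "inj \<sigma>"
  shows "(\<Sum>j\<in>UNIV. d j *\<^sub>R axis (\<sigma> j) (axis (\<sigma> j) 1) :: real^'n^'n) $ \<sigma> l $ \<sigma> l = d (l::'m::finite)"
  using assms by (simp add: axis_def inj_eq if_distrib[of "\<lambda>x. x $ _"] if_distrib[of "\<lambda>x. _ * x"] cong: if_cong)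

lemma spectral_norm_diagonal_le:
  fixes A :: "real^'n^'n"
  assumes "diagonal_matrix A" "\<And>i. \<bar>A $ i $ i\<bar> \<le> B"
  shows "spectral_norm A \<le> B"
  unfolding spectral_norm_def
proof (rule onorm_le)
  fix v :: "real^'n"
  have "(A *v v) $ i = A $ i $ i * v $ i" for i
    using assms(1) by (simp add: matrix_vector_mult_def diagonal_matrix_def sum.remove[of _ i])
  then have "norm ((A *v v) $ i) \<le> norm ((B *\<^sub>R v) $ i)" for i
    using assms(2)[of i] by (auto simp: abs_mult intro!: mult_right_mono)
  then have "norm (A *v v) \<le> norm (B *\<^sub>R v)"
    by (rule norm_le_componentwise_cart)
  then show "norm (A *v v) \<le> B * norm v"
    using assms(2) by (metis norm_scaleR abs_of_nonneg abs_ge_zero order_trans)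
qed

text \<open>Diagonal entries outside the range of \<open>\<sigma>\<close> are 0; they obey the bound
  because some \<open>j\<close> exists and forces \<open>0 \<le> B\<close>.\<close>

lemma spectral_norm_diagonal_sum_le:
  fixes \<sigma> :: "'m::finite \<Rightarrow> 'n::finite"
  assumes "inj \<sigma>" "\<And>j. \<bar>d j\<bar> \<le> B"
  shows "spectral_norm (\<Sum>j\<in>UNIV. d j *\<^sub>R axis (\<sigma> j) (axis (\<sigma> j) 1) :: real^'n^'n) \<le> B"
    (is "spectral_norm ?A \<le> B")
proof (rule spectral_norm_diagonal_le)
  show "diagonal_matrix ?A"
    by (auto simp: diagonal_matrix_def axis_def intro!: sum.neutral)
  have "0 \<le> B"
    using assms(2) by (metis abs_ge_zero order_trans)
  show "\<bar>?A $ i $ i\<bar> \<le> B" for i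
  proof (cases "i \<in> range \<sigma>")
    case True
    then show ?thesis using diagonal_sum_nth[OF assms(1), of d] assms(2) by force
  next
    case False
    then have "?A $ i $ i = 0" by (auto simp: axis_def intro!: sum.neutral)
    then show ?thesis using \<open>0 \<le> B\<close> by simp
  qed
qed

theorem corollary16:
  fixes f :: "real^'n \<Rightarrow> real"
    and X U :: "(real^'n) set"
    and x0 :: "real^'n"
    and S :: "real^'m^'n"
    and T :: "'m \<Rightarrow> real^1^'n"
    and D :: "real^'n^'n"
    and L :: real
  assumes "open U" and "U \<subseteq> X" and "C4_on U f"
    and "cball x0 (radius S) \<subseteq> U"
    and "radius S > 0"
    and "\<And>j. T j = columnvector (- column j S)"
    and "centered_simplex_hessian_defined X x0 S T"
    and "rank S \<noteq> 0" and "\<And>j. rank (T j) \<noteq> 0"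
    and "L-lipschitz_on (cball x0 (radius S)) (fderiv (fderiv (fderiv f)))"
    and "diagonal_matrix D" and "\<And>i. D $ i $ i = hessian f x0 $ i $ i"
    and "partial_diagonal_matrix S" and "rank S = CARD('m)"
  shows "spectral_norm (proj_op S T (centered_simplex_hessian f x0 S T)
             - proj_op S T (hessian f x0))
           = spectral_norm (centered_simplex_hessian f x0 S T - proj_op S T D)
       \<and> spectral_norm (centered_simplex_hessian f x0 S T - proj_op S T D)
           \<le> 1 / 12 * L * (radius S)\<^sup>2"
proof -
  obtain D' :: "real^'n^'n" and \<sigma> :: "'m \<Rightarrow> 'n"
    where D': "diagonal_matrix D'" and inj: "inj \<sigma>" and colD: "\<And>j. column j S = column (\<sigma> j) D'"
    using assms(13) unfolding partial_diagonal_matrix_def by blast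
  define a where "a j = D' $ \<sigma> j $ \<sigma> j" for j
  have col: "column j S = axis (\<sigma> j) (a j)" for j
    unfolding colD using D' by (auto simp: a_def column_def axis_def vec_eq_iff diagonal_matrix_def)
  \<comment> \<open>\<open>T j\<close> is the single column \<open>- column j S\<close>, so its
    nonzero rank says that this column does not vanish.\<close>
  have nz: "a j \<noteq> 0" for j
    using assms(9)[of j] unfolding assms(6)
    by (auto simp: col rank_eq_0 columnvector_def vec_eq_iff axis_def split: if_splits)
  define c where "c j = (f (x0 + column j S) + f (x0 - column j S) - 2 * f x0) / (a j)\<^sup>2" for j
  let ?E = "\<lambda>j. axis (\<sigma> j) (axis (\<sigma> j) 1) :: real^'n^'n"
  have colneg: "column j (- S) = - column j S" for j
    by (simp add: column_def vec_eq_iff)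
  have "simplex_hessian f x0 S T = (\<Sum>j\<in>UNIV. c j *\<^sub>R ?E j)"
    using simplex_hessian_reflected[OF inj col nz assms(6)] by (simp add: c_def)
  \<comment> \<open>The same formula is applied with \<open>- a\<close> for \<open>a\<close>. The
    second difference and the square are even, so both halves of the centered Hessian
    coincide.\<close>
  moreover have "simplex_hessian f x0 (- S) (\<lambda>j. - T j) = (\<Sum>j\<in>UNIV. c j *\<^sub>R ?E j)"
  proof -
    have col': "column j (- S) = axis (\<sigma> j) (- a j)" for j
      by (simp add: colneg col vec_eq_iff axis_def)
    have T': "- T j = columnvector (- column j (- S))" for j
      by (simp add: assms(6) colneg vec_eq_iff columnvector_def)
    have nz': "- a j \<noteq> 0" for j
      using nz by simp
    show ?thesis
      unfolding simplex_hessian_reflected[OF inj col' nz' T'] colneg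
      by (simp add: c_def add.commute)
  qed
  ultimately have H: "centered_simplex_hessian f x0 S T = (\<Sum>j\<in>UNIV. c j *\<^sub>R ?E j)"
    by (simp add: centered_simplex_hessian_def flip: scaleR_2)
  note P = proj_op_reflected[OF inj col nz assms(6)]
  \<comment> \<open>The projection fixes the centered Hessian and sees only diagonal entries, where
    \<open>D\<close> and the true Hessian agree. The claimed equality of norms is thus an equality
    of matrices.\<close>
  have "proj_op S T (centered_simplex_hessian f x0 S T) = centered_simplex_hessian f x0 S T"
    unfolding P unfolding H diagonal_sum_nth[OF inj] ..
  moreover have "proj_op S T (hessian f x0) = proj_op S T D"
    by (simp add: P assms(12))
  moreover have "spectral_norm (centered_simplex_hessian f x0 S T - proj_op S T D)
      \<le> 1 / 12 * L * (radius S)\<^sup>2"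
  proof -
    have "\<bar>c j - D $ \<sigma> j $ \<sigma> j\<bar> \<le> 1 / 12 * L * (radius S)\<^sup>2" for j
    proof -
      let ?s = "column j S"
      have s: "?s = a j *\<^sub>R axis (\<sigma> j) 1"
        by (simp add: col vec_eq_iff axis_def)
      have ns: "norm ?s = \<bar>a j\<bar>"
        by (simp add: s norm_axis_1)
      have le: "norm ?s \<le> radius S"
        unfolding radius_def by (intro Max_ge) auto
      have cb: "cball x0 (norm ?s) \<subseteq> cball x0 (radius S)"
        using le by auto
      have L0: "0 \<le> L" using assms(10) by (rule lipschitz_on_nonneg)
      have "norm (f (x0 + ?s) + f (x0 - ?s) - 2 *\<^sub>R f x0 - fderiv (fderiv f) x0 ?s ?s) \<le> L / 12 * norm ?s ^ 4"
        using assms(3,4) cb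
        by (intro second_difference_bound[OF \<open>open U\<close>] lipschitz_on_subset[OF assms(10)])
          (auto simp: C4_on_def)
      moreover have "fderiv (fderiv f) x0 ?s ?s = (a j)\<^sup>2 * D $ \<sigma> j $ \<sigma> j"
        by (simp add: s assms(12) hessian_def blinfun.bilinear_simps power2_eq_square)
      moreover have "f (x0 + ?s) + f (x0 - ?s) - 2 * f x0 = (a j)\<^sup>2 * c j"
        using nz by (simp add: c_def)
      \<comment> \<open>One factor \<open>(a j)\<^sup>2\<close> of the fourth power is split off to
        cancel the denominator of the quotient \<open>c j\<close>.\<close>
      ultimately have "\<bar>(a j)\<^sup>2 * (c j - D $ \<sigma> j $ \<sigma> j)\<bar> \<le> (a j)\<^sup>2 * (L / 12 * (a j)\<^sup>2)"
        by (simp add: ns right_diff_distrib power4_eq_xxxx power2_eq_square mult_ac)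
      then have "\<bar>c j - D $ \<sigma> j $ \<sigma> j\<bar> \<le> L / 12 * (a j)\<^sup>2"
        using nz[of j] by (simp add: abs_mult)
      also have "\<dots> \<le> L / 12 * (radius S)\<^sup>2"
        using L0 le unfolding ns by (intro mult_left_mono) (auto simp: abs_le_square_iff[symmetric])
      finally show ?thesis by simp
    qed
    from spectral_norm_diagonal_sum_le[OF inj this] show ?thesis
      unfolding H P by (simp only: scaleR_left_diff_distrib sum_subtractf)
  qed
  ultimately show ?thesis by simp
qed

end
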